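(* Let $x_0\in\mathbb R$ and let $a,b,c$ be functions analytic at $x_0$, with $a$ not identically zero. Consider the second order ordinary differential equation $$a(x)y''+b(x)y'+c(x)y=0 .$$ Suppose that there exist two linearly independent formal solutions $\hat y_1(x)$ and $\hat y_2(x)$ centered at $x_0$ of this equation. Then $x_0$ is an ordinary point or a regular singular point of the equation. Moreover, $\hat y_1(x)$ and $\hat y_2(x)$ are convergent.
   Context: A formal solution centered at $x_0$ is a formal power series $\hat y(x)=\sum_{n\ge 0}a_n(x-x_0)^n$ with coefficients $a_n\in\mathbb C$ which satisfies the equation as an identity of formal power series (coefficients of the equation replaced by their Taylor series at $x_0$). It is convergent if it has positive radius of convergence. The point $x_0$ is an ordinary point if $a(x_0)\neq 0$ and a singular point if $a(x_0)=0$. A singular point $x_0$ is a regular singular point if $(x-x_0)\frac{b(x)}{a(x)}$ and $(x-x_0)^2\frac{c(x)}{a(x)}$ have finite limits as $x\to x_0$ (equivalently, extend analytically to $x_0$). *)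

theory Defs
  imports "HOL-Complex_Analysis.Complex_Analysis"
begin

text \<open>
  The equation is \<open>a y'' + b y' + c y = 0\<close>. The coefficients are given as complex functions
  that are analytic at the centre, i.e. as holomorphic extensions of functions of a real variable.
  A formal series in powers of \<open>x - x0\<close> is a value of type \<^typ>\<open>complex fps\<close>, so the
  formal variable \<^term>\<open>fps_X\<close> stands for \<open>x - x0\<close>, and \<^term>\<open>fps_expansion a x0\<close> is
  the Taylor series of \<open>a\<close> at \<open>x0\<close>.
\<close>

definition formal_solution ::
  "(complex \<Rightarrow> complex) \<Rightarrow> (complex \<Rightarrow> complex) \<Rightarrow> (complex \<Rightarrow> complex) \<Rightarrow> complex
    \<Rightarrow> complex fps \<Rightarrow> bool" where
  "formal_solution a b c x0 y \<longleftrightarrow>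
     fps_expansion a x0 * fps_deriv (fps_deriv y) + fps_expansion b x0 * fps_deriv y
       + fps_expansion c x0 * y = 0"

definition lin_indep_pair :: "complex fps \<Rightarrow> complex fps \<Rightarrow> bool" where
  "lin_indep_pair y1 y2 \<longleftrightarrow>
     (\<forall>u v. fps_const u * y1 + fps_const v * y2 = 0 \<longrightarrow> u = 0 \<and> v = 0)"

definition convergent_fps :: "complex fps \<Rightarrow> bool" where
  "convergent_fps y \<longleftrightarrow> fps_conv_radius y > 0"

definition ordinary_point :: "(complex \<Rightarrow> complex) \<Rightarrow> complex \<Rightarrow> bool" where
  "ordinary_point a x0 \<longleftrightarrow> a x0 \<noteq> 0"

definition singular_point :: "(complex \<Rightarrow> complex) \<Rightarrow> complex \<Rightarrow> bool" where
  "singular_point a x0 \<longleftrightarrow> a x0 = 0"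

text \<open>
  The convention \<open>z / 0 = 0\<close> does not affect the limits below when \<open>a\<close> is analytic at \<open>x0\<close>
  and its germ there is nonzero: its zeros are then isolated, so \<open>a\<close> does not vanish on a punctured
  neighbourhood of \<open>x0\<close>.
\<close>

definition regular_singular_point ::
  "(complex \<Rightarrow> complex) \<Rightarrow> (complex \<Rightarrow> complex) \<Rightarrow> (complex \<Rightarrow> complex) \<Rightarrow> complex \<Rightarrow> bool" where
  "regular_singular_point a b c x0 \<longleftrightarrow>
     singular_point a x0 \<and>
     (\<exists>L. ((\<lambda>x. (x - x0) * (b x / a x)) \<longlongrightarrow> L) (at x0)) \<and>
     (\<exists>L. ((\<lambda>x. (x - x0)\<^sup>2 * (c x / a x)) \<longlongrightarrow> L) (at x0))"

end

theory Submission
  imports Defs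
begin

text \<open>
  Multiplied by \<open>x\<^sup>2\<close> (with \<open>x0 = 0\<close>), the equation reads
  \<open>a x\<^sup>2 y'' + (x b) x y' + (x\<^sup>2 c) y = 0\<close>, and its lowest-order part is \<open>x\<^sup>m\<close> times an Euler
  operator, whose action on \<open>x\<^sup>k\<close> is multiplication by a polynomial \<open>I(k)\<close> of degree at most 2. The
  order of any nonzero formal solution is a root of \<open>I\<close>. Two independent solutions can be combined
  to have different orders, so \<open>I\<close> has two roots while being nonzero; hence its degree is exactly 2,
  which says that the order of \<open>a\<close> does not exceed those of \<open>x b\<close> and \<open>x\<^sup>2 c\<close>. Moreover
  \<open>I(n)\<close> grows like \<open>n\<^sup>2\<close>, as fast as the other factors in the recurrence for the coefficients
  of a solution, which forces these coefficients to grow at most geometrically.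
\<close>

unbundle no vec_syntax

section \<open>Geometric growth of coefficients\<close>

text \<open>The terms at a positive radius \<open>r\<close> are bounded; conversely, a geometric
  bound is compared with a geometric series of ratio 1/2. The exponent \<open>Suc n\<close> lets the
  single constant \<open>K\<close> absorb a constant factor as well as the growth rate.\<close>

lemma fps_conv_radius_pos_iff:
  fixes f :: "complex fps"
  shows "fps_conv_radius f > 0 \<longleftrightarrow> (\<exists>K. \<forall>n. norm (f $ n) \<le> K ^ Suc n)"
proof
  assume "fps_conv_radius f > 0"
  then obtain r where r: "ereal r < fps_conv_radius f" "r > 0"
    by (metis ereal_dense2 ereal_less(2))
  have "summable (\<lambda>n. norm (f $ n * of_real r ^ n))"
    using r by (intro norm_summable_fps) auto
  then have "Bseq (\<lambda>n. norm (f $ n * of_real r ^ n))"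
    by (intro convergent_imp_Bseq) (auto simp: convergent_def dest: summable_LIMSEQ_zero)
  then obtain M where M: "M > 0" "\<And>n. norm (f $ n) * r ^ n \<le> M"
    using r by (auto simp: Bseq_def norm_mult norm_power)
  define K where "K = max M (1 / r)"
  have "norm (f $ n) \<le> K ^ Suc n" for n
  proof -
    have "norm (f $ n) \<le> M * (1 / r) ^ n"
      using M(2)[of n] r by (simp add: field_simps)
    also have "\<dots> \<le> K * K ^ n"
      using M r by (intro mult_mono power_mono) (auto simp: K_def)
    finally show ?thesis by simp
  qed
  then show "\<exists>K. \<forall>n. norm (f $ n) \<le> K ^ Suc n" by blast
next
  assume "\<exists>K. \<forall>n. norm (f $ n) \<le> K ^ Suc n"
  then obtain K where K: "\<And>n. norm (f $ n) \<le> K ^ Suc n" by blast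
  have K0: "K \<ge> 0" using order_trans[OF norm_ge_zero K[of 0]] by simp
  define r where "r = 1 / (2 * (K + 1))"
  have r: "r > 0" "K * r \<le> 1 / 2" using K0 by (auto simp: r_def field_simps)
  have "summable (\<lambda>n. f $ n * of_real r ^ n)"
  proof (rule summable_comparison_test[OF exI, rule_format])
    fix n :: nat
    have "norm (f $ n * of_real r ^ n) = norm (f $ n) * r ^ n"
      using r by (simp add: norm_mult norm_power)
    also have "\<dots> \<le> K ^ Suc n * r ^ n"
      using r K by (intro mult_right_mono) auto
    also have "\<dots> = K * (K * r) ^ n" by (simp add: power_mult_distrib)
    also have "\<dots> \<le> K * (1 / 2) ^ n"
      using r K0 by (intro mult_left_mono power_mono) auto
    finally show "norm (f $ n * of_real r ^ n) \<le> K * (1 / 2) ^ n" .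
  qed (auto intro: summable_mult summable_geometric)
  then have "conv_radius (fps_nth f) \<ge> norm (complex_of_real r)"
    by (rule conv_radius_geI)
  then show "fps_conv_radius f > 0"
    using r by (auto simp: fps_conv_radius_def intro: less_le_trans[of _ "ereal r"])
qed

text \<open>A majorant argument: \<open>E * L ^ n\<close> dominates \<open>u\<close>, because
  \<open>L ^ n\<close> itself satisfies the recurrence inequality for a suitable
  \<open>L\<close>.\<close>

lemma geometric_growth_of_recurrence:
  fixes u :: "nat \<Rightarrow> real"
  assumes "K > 0" "D > 0"
    and u: "\<And>n. u n \<ge> 0"
    and rec: "\<And>n. n \<ge> N \<Longrightarrow> u n \<le> D * (\<Sum>k<n. K ^ (n - k) * u k)"
  shows "\<exists>L. \<forall>n. u n \<le> L ^ Suc n"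
proof -
  \<comment> \<open>This \<open>L\<close> gives \<open>L - K = K * D\<close>, so the sum in the
    recurrence, taken for \<open>L ^ k\<close>, equals \<open>L ^ n - K ^ n\<close> exactly. The
    factor \<open>E\<close> covers the initial values below \<open>N\<close>.\<close>
  define L where "L = K * (1 + D)"
  define E where "E = (\<Sum>i<N. u i / L ^ i)"
  have L: "L > 0" "L - K = K * D"
    using assms(1,2) by (auto simp: L_def algebra_simps intro!: add_pos_pos)
  have E: "E \<ge> 0" unfolding E_def using L u by (intro sum_nonneg) auto
  have "u n \<le> E * L ^ n" for n
  proof (induction n rule: less_induct)
    case (less n)
    show ?case
    proof (cases "n < N")
      case True
      then have "u n / L ^ n \<le> E"
        unfolding E_def using L u by (intro member_le_sum) auto
      then show ?thesis using L by (simp add: field_simps)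
    next
      case False
      have geo: "D * (\<Sum>k<n. K ^ (n - k) * L ^ k) = L ^ n - K ^ n"
      proof -
        have "(\<Sum>k<n. K ^ (n - k) * L ^ k) = K * (\<Sum>k<n. K ^ (n - Suc k) * L ^ k)"
          unfolding sum_distrib_left by (intro sum.cong) (auto simp: Suc_diff_Suc simp flip: power_Suc)
        then show ?thesis
          using power_diff_sumr2[of L n K] L(2) by (simp add: algebra_simps)
      qed
      have "u n \<le> D * (\<Sum>k<n. K ^ (n - k) * u k)" using rec False by simp
      also have "\<dots> \<le> D * (\<Sum>k<n. K ^ (n - k) * (E * L ^ k))"
        using assms less by (intro mult_left_mono sum_mono) auto
      also have "\<dots> = E * (D * (\<Sum>k<n. K ^ (n - k) * L ^ k))"
        by (simp add: sum_distrib_left mult_ac)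
      also have "\<dots> \<le> E * L ^ n"
        unfolding geo using E assms by (intro mult_left_mono) auto
      finally show ?thesis .
    qed
  qed
  moreover have "E * L ^ n \<le> max E L ^ Suc n" for n
    using E L by (auto intro!: mult_mono power_mono)
  ultimately show ?thesis by (meson order_trans)
qed

section \<open>The Euler form of the equation and its indicial polynomial\<close>

text \<open>This is the coefficient of \<open>x^(j + k)\<close> in P x^2 y'' + Q x y' + R y for
  \<open>y = x^k\<close>. When \<open>j\<close> is the lowest order present in \<open>P\<close>,
  \<open>Q\<close>, \<open>R\<close>, it is the indicial polynomial evaluated at \<open>k\<close>.
  The truncated \<open>k - 1\<close> is harmless, since the factor \<open>k\<close> vanishes at
  0.\<close>

definition euler_coeff ::
  "'a::comm_ring_1 fps \<Rightarrow> 'a fps \<Rightarrow> 'a fps \<Rightarrow> nat \<Rightarrow> nat \<Rightarrow> 'a" where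
  "euler_coeff P Q R j k = P $ j * (of_nat k * of_nat (k - 1)) + Q $ j * of_nat k + R $ j"

lemma euler_recurrence:
  fixes A B C y :: "'a::comm_ring_1 fps"
  assumes "A * fps_deriv (fps_deriv y) + B * fps_deriv y + C * y = 0"
  shows "(\<Sum>k\<le>n. euler_coeff A (fps_X * B) (fps_X\<^sup>2 * C) (n - k) k * y $ k) = 0"
proof -
  let ?d = "\<lambda>y :: 'a fps. fps_X * fps_deriv y"
  have d1: "?d y $ k = of_nat k * y $ k" for k
    by (cases k) auto
  have d2: "(fps_X\<^sup>2 * fps_deriv (fps_deriv y)) $ k = of_nat k * of_nat (k - 1) * y $ k" for k
    by (cases k; cases "k - 1") (auto simp: power2_eq_square mult.assoc algebra_simps)
  have "0 = fps_X\<^sup>2 * (A * fps_deriv (fps_deriv y) + B * fps_deriv y + C * y)"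
    using assms by simp
  also have "\<dots> = (fps_X\<^sup>2 * fps_deriv (fps_deriv y)) * A + ?d y * (fps_X * B) + y * (fps_X\<^sup>2 * C)"
    by (simp add: algebra_simps power2_eq_square)
  finally have "0 = (\<dots>) $ n" by simp
  also have "\<dots> = (\<Sum>k\<le>n. euler_coeff A (fps_X * B) (fps_X\<^sup>2 * C) (n - k) k * y $ k)"
    unfolding fps_add_nth fps_mult_nth[of _ _ n] d1 d2 euler_coeff_def atLeast0AtMost
    by (simp add: sum.distrib[symmetric] algebra_simps)
  finally show ?thesis by simp
qed

text \<open>In the recurrence at index \<open>m + subdegree y\<close>, smaller \<open>k\<close> meet
  a zero coefficient of \<open>y\<close> and larger \<open>k\<close> a zero coefficient of the
  equation. Only the leading term survives.\<close>

lemma euler_coeff_subdegree_eq_0: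
  fixes P Q R y :: "'a::idom fps"
  assumes rec: "\<And>n. (\<Sum>k\<le>n. euler_coeff P Q R (n - k) k * y $ k) = 0"
    and low: "\<And>j. j < m \<Longrightarrow> P $ j = 0 \<and> Q $ j = 0 \<and> R $ j = 0"
    and "y \<noteq> 0"
  shows "euler_coeff P Q R m (subdegree y) = 0"
proof -
  let ?r = "subdegree y"
  have "0 = (\<Sum>k\<le>m + ?r. euler_coeff P Q R (m + ?r - k) k * y $ k)"
    using rec by simp
  also have "\<dots> = (\<Sum>k\<in>{?r}. euler_coeff P Q R (m + ?r - k) k * y $ k)"
  proof (rule sum.mono_neutral_right)
    show "\<forall>k\<in>{..m + ?r} - {?r}. euler_coeff P Q R (m + ?r - k) k * y $ k = 0"
    proof
      fix k assume "k \<in> {..m + ?r} - {?r}"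
      then consider "k < ?r" | "m + ?r - k < m" by fastforce
      then show "euler_coeff P Q R (m + ?r - k) k * y $ k = 0"
        by cases (auto simp: euler_coeff_def low nth_less_subdegree_zero)
    qed
  qed auto
  also have "\<dots> = euler_coeff P Q R m ?r * y $ ?r" by simp
  finally show ?thesis using \<open>y \<noteq> 0\<close> by simp
qed

text \<open>With \<open>P $ m = 0\<close> the indicial polynomial has degree at most 1 in
  \<open>k\<close>, so two distinct roots annihilate it.\<close>

lemma euler_coeff_two_roots:
  fixes P Q R :: "'a::{idom, ring_char_0} fps"
  assumes "euler_coeff P Q R m r = 0" "euler_coeff P Q R m s = 0" "r \<noteq> s" "P $ m = 0"
  shows "Q $ m = 0" "R $ m = 0"
proof -
  have "Q $ m * (of_nat r - of_nat s) = 0"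
  proof -
    have "Q $ m * (of_nat r - of_nat s) = euler_coeff P Q R m r - euler_coeff P Q R m s"
      using assms(4) by (simp add: euler_coeff_def algebra_simps)
    then show ?thesis using assms(1,2) by simp
  qed
  then show "Q $ m = 0" using assms by simp
  then show "R $ m = 0" using assms by (simp add: euler_coeff_def)
qed

section \<open>Convergence of formal solutions\<close>

text \<open>Since \<open>P $ m \<noteq> 0\<close>, the factor of \<open>y $ n\<close> in the
  recurrence is at least a multiple of \<open>n^2\<close>. All other factors are at most
  \<open>n^2\<close> times a geometric term, so \<open>n^2\<close> cancels and
  \<open>geometric_growth_of_recurrence\<close> applies.\<close>

lemma convergent_fps_if_euler_recurrence:
  assumes rec: "\<And>n. (\<Sum>k\<le>n. euler_coeff P Q R (n - k) k * y $ k) = 0"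
    and low: "\<And>j. j < m \<Longrightarrow> P $ j = 0 \<and> Q $ j = 0 \<and> R $ j = 0"
    and "P $ m \<noteq> 0"
    and conv: "convergent_fps P" "convergent_fps Q" "convergent_fps R"
  shows "convergent_fps y"
proof -
  let ?F = "euler_coeff P Q R"
  from conv obtain K1 K2 K3 where K123: "\<And>n. norm (P $ n) \<le> K1 ^ Suc n"
      "\<And>n. norm (Q $ n) \<le> K2 ^ Suc n" "\<And>n. norm (R $ n) \<le> K3 ^ Suc n"
    unfolding convergent_fps_def fps_conv_radius_pos_iff by metis
  define K where "K = Max {1, K1, K2, K3}"
  have K_ge: "K \<ge> 1" "K \<ge> K1" "K \<ge> K2" "K \<ge> K3" by (auto simp: K_def)
  have K123_nonneg: "K1 \<ge> 0" "K2 \<ge> 0" "K3 \<ge> 0"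
    using K123[of 0] norm_ge_zero order_trans by (metis power_one_right One_nat_def)+
  have K: "norm (P $ n) \<le> K ^ Suc n" "norm (Q $ n) \<le> K ^ Suc n" "norm (R $ n) \<le> K ^ Suc n" for n
    using K123[of n] K_ge K123_nonneg power_mono[of _ K "Suc n"] by (meson order_trans)+
  have upper: "norm (?F j k) \<le> 3 * real n ^ 2 * K ^ Suc j" if "k < n" for j k n
  proof -
    have "real k * real (k - 1) \<le> real n * real n"
      using that by (intro mult_mono) auto
    moreover have "real k \<le> real n * real n" "1 \<le> real n * real n"
      using that by (auto simp flip: of_nat_mult intro: order_trans[OF _ le_square])
    moreover have "norm (?F j k) \<le> norm (P $ j) * (real k * real (k - 1))
        + norm (Q $ j) * real k + norm (R $ j) * 1"
      unfolding euler_coeff_def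
      by (intro norm_triangle_le add_mono) (auto simp: norm_mult)
    ultimately have "norm (?F j k) \<le> K ^ Suc j * (real n * real n)
        + K ^ Suc j * (real n * real n) + K ^ Suc j * (real n * real n)"
      using K[of j] K_ge that by (intro order_trans[OF \<open>norm (?F j k) \<le> _\<close>] add_mono mult_mono) auto
    then show ?thesis by (simp add: power2_eq_square algebra_simps)
  qed
  define \<alpha> where "\<alpha> = norm (P $ m)"
  have \<alpha>: "\<alpha> > 0" using assms by (simp add: \<alpha>_def)
  \<comment> \<open>For \<open>n \<ge> 1\<close> the indicial polynomial has norm at least
    \<open>\<alpha> n^2 - S n\<close>; from \<open>N\<close> on, \<open>S n\<close> takes away at
    most half of the quadratic term.\<close>
  define S where "S = \<alpha> + norm (Q $ m) + norm (R $ m)"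
  define N where "N = Suc (nat \<lceil>2 * S / \<alpha>\<rceil>)"
  have lower: "norm (?F m n) \<ge> \<alpha> / 2 * real n ^ 2" if "n \<ge> N" for n
  proof -
    have n: "real n \<ge> 1" "real n \<ge> 2 * S / \<alpha>" using that by (auto simp: N_def) linarith+
    then have "S \<le> \<alpha> / 2 * real n" using \<alpha> by (simp add: field_simps)
    then have "S * real n \<le> \<alpha> / 2 * real n * real n" by (intro mult_right_mono) auto
    moreover have "norm (R $ m) * 1 \<le> norm (R $ m) * real n"
      using n by (intro mult_left_mono) auto
    moreover have "\<alpha> * (real n * real (n - 1))
        \<le> norm (?F m n) + norm (Q $ m) * real n + norm (R $ m)"
    proof -
      have "P $ m * (of_nat n * of_nat (n - 1)) = ?F m n - Q $ m * of_nat n - R $ m"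
        by (simp add: euler_coeff_def)
      then have "norm (P $ m * (of_nat n * of_nat (n - 1)))
          \<le> norm (?F m n) + norm (Q $ m * of_nat n) + norm (R $ m)"
        by (simp only:) (intro order_trans[OF norm_triangle_ineq4] add_right_mono norm_triangle_ineq4)
      then show ?thesis by (simp only: norm_mult norm_of_nat \<alpha>_def)
    qed
    moreover have "real (n - 1) = real n - 1" using n by (simp add: of_nat_diff)
    ultimately show ?thesis
      by (simp add: S_def power2_eq_square algebra_simps)
  qed
  \<comment> \<open>The ratio of the upper factor \<open>3 n^2 K ^ Suc m\<close> to the lower bound
    \<open>\<alpha> / 2 * n^2\<close>.\<close>
  define D where "D = 6 * K ^ Suc m / \<alpha>"
  have D: "D > 0" using \<alpha> K_ge by (auto simp: D_def)
  have "norm (y $ n) \<le> D * (\<Sum>k<n. K ^ (n - k) * norm (y $ k))" if "n \<ge> N" for n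
  proof -
    have n: "real n > 0" using that by (simp add: N_def)
    \<comment> \<open>Index \<open>m + n\<close> is the one at which \<open>y $ n\<close> is the
      last coefficient to occur, with the indicial polynomial as its factor.\<close>
    have "0 = (\<Sum>k\<le>m + n. ?F (m + n - k) k * y $ k)" using rec by simp
    also have "\<dots> = (\<Sum>k\<le>n. ?F (m + n - k) k * y $ k)"
      by (rule sum.mono_neutral_right) (auto simp: euler_coeff_def low)
    also have "\<dots> = ?F m n * y $ n + (\<Sum>k<n. ?F (m + n - k) k * y $ k)"
      by (simp add: lessThan_Suc_atMost[symmetric])
    finally have "norm (?F m n * y $ n) = norm (\<Sum>k<n. ?F (m + n - k) k * y $ k)"
      by (metis add_eq_0_iff norm_minus_cancel)
    also have "\<dots> \<le> (\<Sum>k<n. 3 * real n ^ 2 * K ^ Suc (m + n - k) * norm (y $ k))"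
      by (intro sum_norm_le, unfold norm_mult, intro mult_right_mono upper) auto
    also have "\<dots> = (\<Sum>k<n. 3 * real n ^ 2 * K ^ Suc m * (K ^ (n - k) * norm (y $ k)))"
    proof (intro sum.cong refl)
      fix k assume "k \<in> {..<n}"
      then have "Suc (m + n - k) = Suc m + (n - k)" by auto
      then show "3 * real n ^ 2 * K ^ Suc (m + n - k) * norm (y $ k) =
          3 * real n ^ 2 * K ^ Suc m * (K ^ (n - k) * norm (y $ k))"
        by (simp only: power_add mult_ac)
    qed
    also have "\<dots> = 3 * real n ^ 2 * K ^ Suc m * (\<Sum>k<n. K ^ (n - k) * norm (y $ k))"
      by (simp only: sum_distrib_left)
    also have "\<dots> = \<alpha> / 2 * real n ^ 2 * (D * (\<Sum>k<n. K ^ (n - k) * norm (y $ k)))"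
      using \<alpha> by (simp add: D_def)
    finally have "\<alpha> / 2 * real n ^ 2 * norm (y $ n) \<le> \<dots>"
      using mult_right_mono[OF lower[OF that], of "norm (y $ n)"] by (simp add: norm_mult)
    then show ?thesis using \<alpha> n by (subst (asm) mult_le_cancel_left_pos) auto
  qed
  from geometric_growth_of_recurrence[OF _ D _ this] K_ge show ?thesis
    unfolding convergent_fps_def fps_conv_radius_pos_iff by auto
qed

section \<open>Solutions of different orders\<close>

lemma formal_solution_linear_combination:
  assumes "formal_solution a b c x0 y1" "formal_solution a b c x0 y2"
  shows "formal_solution a b c x0 (fps_const u * y1 - fps_const v * y2)"
proof -
  let ?L = "\<lambda>y. fps_expansion a x0 * fps_deriv (fps_deriv y)
    + fps_expansion b x0 * fps_deriv y + fps_expansion c x0 * y"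
  have "?L (fps_const u * y1 - fps_const v * y2) = fps_const u * ?L y1 - fps_const v * ?L y2"
    by (simp add: algebra_simps)
  then show ?thesis using assms by (simp add: formal_solution_def)
qed

lemma independent_solutions_distinct_subdegree:
  assumes "formal_solution a b c x0 y1" "formal_solution a b c x0 y2" "lin_indep_pair y1 y2"
  obtains z w where "formal_solution a b c x0 z" "formal_solution a b c x0 w"
    "z \<noteq> 0" "w \<noteq> 0" "subdegree z \<noteq> subdegree w"
proof -
  have ind: "fps_const u * y1 + fps_const v * y2 = 0 \<Longrightarrow> u = 0 \<and> v = 0" for u v
    using assms(3) by (simp add: lin_indep_pair_def)
  have nz: "y1 \<noteq> 0" "y2 \<noteq> 0" using ind[of 1 0] ind[of 0 1] by auto
  show thesis
  proof (cases "subdegree y1 = subdegree y2")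
    case False
    then show thesis using that assms nz by blast
  next
    case True
    define r where "r = subdegree y1"
    \<comment> \<open>The combination cancels the common leading term, and independence keeps it
      nonzero.\<close>
    define w where "w = fps_const (y2 $ r) * y1 - fps_const (y1 $ r) * y2"
    have r: "y1 $ r \<noteq> 0" "y2 $ r \<noteq> 0" using nz True by (metis nth_subdegree_nonzero r_def)+
    have "w \<noteq> 0"
      using ind[of "y2 $ r" "- (y1 $ r)"] r by (auto simp: w_def simp flip: fps_const_neg)
    moreover have "w $ r = 0" by (simp add: w_def mult.commute)
    ultimately have "subdegree y1 \<noteq> subdegree w" by (metis nth_subdegree_nonzero r_def)
    then show thesis
      using that[of y1 w] assms nz \<open>w \<noteq> 0\<close> formal_solution_linear_combination
      unfolding w_def by blast
  qed
qed

section \<open>Limits of quotients and the conclusion\<close>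

text \<open>The numerator vanishes at least to the order \<open>m\<close> of the denominator, so
  \<open>F / G\<close> is a power series and the singularity is removable. The case
  \<open>F = 0\<close> is separate because its \<open>subdegree\<close> is 0 by convention.\<close>

lemma tendsto_quotient_if_subdegree_le:
  fixes f g :: "complex \<Rightarrow> complex"
  assumes "(\<lambda>x. f (x0 + x)) has_fps_expansion F" "(\<lambda>x. g (x0 + x)) has_fps_expansion G"
    and "G $ m \<noteq> 0" "\<And>j. j < m \<Longrightarrow> G $ j = 0" "\<And>j. j < m \<Longrightarrow> F $ j = 0"
  shows "\<exists>L. ((\<lambda>x. f x / g x) \<longlongrightarrow> L) (at x0)"
proof -
  have m: "subdegree G = m" using assms by (intro subdegreeI) auto
  have L: "\<exists>L. ((\<lambda>x. f (x0 + x) / g (x0 + x)) \<longlongrightarrow> L) (at 0)"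
  proof (cases "F = 0")
    case True
    then have "eventually (\<lambda>x. f (x0 + x) = 0) (at 0)"
      using assms(1) by (auto simp: has_fps_expansion_def eventually_at_filter elim: eventually_mono)
    then have "((\<lambda>x. f (x0 + x) / g (x0 + x)) \<longlongrightarrow> 0) (at 0)"
      by (intro tendsto_eventually) (auto elim: eventually_mono)
    then show ?thesis by blast
  next
    case False
    \<comment> \<open>The constant coefficient of \<open>F / G\<close>, hence the value that fills
      the removable singularity.\<close>
    define q where "q = F $ m / G $ m"
    have "m \<le> subdegree F" using False assms by (intro subdegree_geI) auto
    then have "(\<lambda>x. if x = 0 then q else f (x0 + x) / g (x0 + x)) has_fps_expansion F / G"
      using assms m by (intro has_fps_expansion_divide) (auto simp: q_def)
    then have "continuous (at 0) (\<lambda>x. if x = 0 then q else f (x0 + x) / g (x0 + x))"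
      by (rule has_fps_expansion_imp_continuous)
    then have "((\<lambda>x. if x = 0 then q else f (x0 + x) / g (x0 + x)) \<longlongrightarrow> q) (at 0)"
      by (simp add: continuous_within)
    then have "((\<lambda>x. f (x0 + x) / g (x0 + x)) \<longlongrightarrow> q) (at 0)"
      by (rule Lim_transform_eventually) (auto simp: eventually_at_filter)
    then show ?thesis by blast
  qed
  then show ?thesis by (simp add: filterlim_at_to_0[of _ _ x0] add.commute)
qed

theorem theorem1:
  fixes x0 :: real and a b c :: "complex \<Rightarrow> complex" and y1 y2 :: "complex fps"
  assumes "a analytic_on {of_real x0}"
    and "b analytic_on {of_real x0}"
    and "c analytic_on {of_real x0}"
    and "\<not> (\<forall>\<^sub>F x in nhds (of_real x0). a x = 0)"
    and "formal_solution a b c (of_real x0) y1"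
    and "formal_solution a b c (of_real x0) y2"
    and "lin_indep_pair y1 y2"
  shows "(ordinary_point a (of_real x0) \<or> regular_singular_point a b c (of_real x0))
         \<and> convergent_fps y1 \<and> convergent_fps y2"
proof -
  define x where "x = complex_of_real x0"
  note assms = assms[folded x_def]
  define P where "P = fps_expansion a x"
  define Q where "Q = fps_X * fps_expansion b x"
  define R where "R = fps_X\<^sup>2 * fps_expansion c x"
  have a: "(\<lambda>z. a (x + z)) has_fps_expansion P"
    unfolding P_def by (intro analytic_at_imp_has_fps_expansion assms)
  have b: "(\<lambda>z. z * b (x + z)) has_fps_expansion Q"
    unfolding Q_def by (intro fps_expansion_intros analytic_at_imp_has_fps_expansion assms)
  have c: "(\<lambda>z. z\<^sup>2 * c (x + z)) has_fps_expansion R"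
    unfolding R_def by (intro fps_expansion_intros analytic_at_imp_has_fps_expansion assms)
  have rec: "(\<Sum>k\<le>n. euler_coeff P Q R (n - k) k * y $ k) = 0" if "formal_solution a b c x y" for y n
    using that unfolding P_def Q_def R_def formal_solution_def by (rule euler_recurrence)
  have "P \<noteq> 0"
  proof
    assume "P = 0"
    then have "eventually (\<lambda>z. a (x + z) = 0) (nhds 0)"
      using a by (auto simp: has_fps_expansion_def elim: eventually_mono)
    then have "eventually (\<lambda>z. a z = 0) (nhds x)"
      by (simp add: nhds_to_0[of x] eventually_filtermap add.commute)
    then show False using assms by simp
  qed
  then have "\<exists>j. P $ j \<noteq> 0 \<or> Q $ j \<noteq> 0 \<or> R $ j \<noteq> 0"
    by (auto simp: fps_eq_iff)
  \<comment> \<open>\<open>m\<close> is the lowest order among the three coefficients of the Euler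
    form, so the indicial polynomial at \<open>m\<close> is not zero.\<close>
  then obtain m where m: "P $ m \<noteq> 0 \<or> Q $ m \<noteq> 0 \<or> R $ m \<noteq> 0"
    and low: "\<And>j. j < m \<Longrightarrow> P $ j = 0 \<and> Q $ j = 0 \<and> R $ j = 0"
    using exists_least_iff[of "\<lambda>j. P $ j \<noteq> 0 \<or> Q $ j \<noteq> 0 \<or> R $ j \<noteq> 0"] by blast
  obtain z w where "formal_solution a b c x z" "formal_solution a b c x w"
      "z \<noteq> 0" "w \<noteq> 0" "subdegree z \<noteq> subdegree w"
    using independent_solutions_distinct_subdegree assms by blast
  \<comment> \<open>If \<open>P $ m\<close> were 0, the two distinct orders would be roots that
    force \<open>Q $ m\<close> and \<open>R $ m\<close> to vanish too, against the choice of
    \<open>m\<close>.\<close>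
  then have Pm: "P $ m \<noteq> 0"
    using m euler_coeff_two_roots euler_coeff_subdegree_eq_0[OF rec low] by metis
  have conv: "convergent_fps P" "convergent_fps Q" "convergent_fps R"
    using a b c by (auto simp: has_fps_expansion_def convergent_fps_def)
  have "convergent_fps y1" "convergent_fps y2"
    using convergent_fps_if_euler_recurrence[OF rec low Pm conv] assms by blast+
  moreover have "regular_singular_point a b c x" if "a x = 0"
  proof -
    \<comment> \<open>By \<open>low\<close> and \<open>Pm\<close>, neither \<open>Q\<close> nor
      \<open>R\<close> has smaller order than \<open>P\<close>, which is exactly the condition for
      finite limits.\<close>
    have "\<exists>L. ((\<lambda>z. ((z - x) * b z) / a z) \<longlongrightarrow> L) (at x)"
      using b a Pm low by (intro tendsto_quotient_if_subdegree_le) auto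
    moreover have "\<exists>L. ((\<lambda>z. ((z - x)\<^sup>2 * c z) / a z) \<longlongrightarrow> L) (at x)"
      using c a Pm low by (intro tendsto_quotient_if_subdegree_le) auto
    ultimately show ?thesis
      using that by (simp add: regular_singular_point_def singular_point_def)
  qed
  ultimately show ?thesis by (auto simp: ordinary_point_def x_def)
qed

end
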